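(* Let $l\ge 1$ and $N\ge l$ be integers, let $1\le M_1<\cdots<M_l\le N$ be integers, and let $0<p_0<p_1<\cdots<p_l<1$. Set $M_0=0$ and $M_{l+1}=N+1$. Let $\{X_n\}_{n=0}^\infty$ be the random walk on $\mathbb{Z}$ excited by its recent history with history window $N$, thresholds $M_1,\dots,M_l$ and probabilities $p_0,\dots,p_l$. Then the speed $s(N,M_1,\dots,M_l;p_0,\dots,p_l):=\lim_{n\to\infty}\frac{X_n}{n}$ exists almost surely (as a deterministic constant) and is given by $$ s(N,M_1,\dots,M_l;p_0,\dots,p_l)=\frac{\sum_{i=0}^l\frac1{1-p_i}\left(\prod_{k=1}^i\left(\frac{p_{k-1}}{1-p_{k-1}}\right)^{M_k-M_{k-1}}\right)\sum_{j=M_i}^{M_{i+1}-1}\left(\frac{2j}{N}-1\right)\binom Nj\left(\frac{p_i}{1-p_i}\right)^{j-M_i}}{\sum_{i=0}^l\frac1{1-p_i}\left(\prod_{k=1}^i\left(\frac{p_{k-1}}{1-p_{k-1}}\right)^{M_k-M_{k-1}}\right)\sum_{j=M_i}^{M_{i+1}-1}\binom Nj\left(\frac{p_i}{1-p_i}\right)^{j-M_i}}, $$ where a void product $\prod_{k=1}^0$ equals $1$.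
   Context: The process (random walk excited by its recent history, $l$ threshold stages): with $M_0=0$ and $M_{l+1}=N+1$, $\{X_n\}_{n=0}^\infty$ takes values in $\mathbb{Z}$, starts from a fixed integer $X_0$, and at each step jumps by $+1$ (right) or $-1$ (left). Each of the first $N$ jumps is, independently, to the right with probability $p_0$ and to the left with probability $1-p_0$. At every subsequent step, conditionally on the whole past: for $i=0,1,\dots,l$, if the number of jumps to the right among the $N$ most recent jumps is between $M_i$ and $M_{i+1}-1$ (inclusive), then the next jump is to the right with probability $p_i$ and to the left with probability $1-p_i$. *)

theory Defs
  imports "HOL-Probability.Probability"
begin

definition jump :: "(nat \<Rightarrow> int) \<Rightarrow> nat \<Rightarrow> int"
  where "jump x k = x (Suc k) - x k"

definition recent_right_jumps :: "nat \<Rightarrow> (nat \<Rightarrow> int) \<Rightarrow> nat \<Rightarrow> nat"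
  where "recent_right_jumps N x n = card {k \<in> {n - N..<n}. jump x k = 1}"

text \<open>
  \<open>\<theta> i\<close> are the thresholds, with the boundary values \<open>\<theta> 0 = 0\<close> and \<open>\<theta> (l + 1) = N + 1\<close> supplied
  where the locale predicate is used. The state space is discrete, so conditioning on the whole past
  is conditioning on each path \<open>x\<close> of the first \<open>n\<close> steps that has positive probability. The
  probability of a jump to the left is the complementary one, by \<open>unit_jumps\<close>.
\<close>
locale recent_history_walk = prob_space P
  for P :: "'a measure" +
  fixes X :: "nat \<Rightarrow> 'a \<Rightarrow> int"
    and x0 :: int
    and N l :: nat
    and \<theta> :: "nat \<Rightarrow> nat"
    and p :: "nat \<Rightarrow> real"
  assumes random_walk: "\<And>n. X n \<in> measurable P (count_space UNIV)"
    and start: "AE \<omega> in P. X 0 \<omega> = x0"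
    and unit_jumps: "\<And>n. AE \<omega> in P. jump (\<lambda>k. X k \<omega>) n \<in> {1, -1}"
    and initial_indep:
      "indep_vars (\<lambda>_. count_space UNIV) (\<lambda>n \<omega>. jump (\<lambda>k. X k \<omega>) n) {..<N}"
    and initial_prob: "\<And>n. n < N \<Longrightarrow> \<P>(\<omega> in P. jump (\<lambda>k. X k \<omega>) n = 1) = p 0"
    and transition_prob:
      "\<And>n x i. N \<le> n \<Longrightarrow> \<P>(\<omega> in P. \<forall>k\<le>n. X k \<omega> = x k) > 0 \<Longrightarrow> i \<le> l \<Longrightarrow>
        recent_right_jumps N x n \<in> {\<theta> i..\<theta> (i + 1) - 1} \<Longrightarrow>
        \<P>(\<omega> in P. jump (\<lambda>k. X k \<omega>) n = 1 \<bar> \<forall>k\<le>n. X k \<omega> = x k) = p i"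

end

theory Submission
  imports Defs
begin

text \<open>
  The last \<open>N\<close> jumps form a finite Markov chain. A law whose weight \<open>weight j\<close> depends on the number
  \<open>j\<close> of right jumps in the window only is stationary as soon as
  \<open>weight (j + 1) * (1 - r (j + 1)) = weight j * r j\<close>, which gives the formula. Let \<open>T\<close> be the
  transition operator on functions of the window. For bounded \<open>h\<close> the sums of
  \<open>h (Y (k + 1)) - T h (Y k)\<close> form a martingale with bounded increments, whose fourth moment is
  \<open>O(n\<^sup>2)\<close>, so that almost surely \<open>h\<close>, \<open>T h\<close>, \<open>T\<^sup>2 h\<close>, \<open>\<dots>\<close> all have the same limiting
  time averages. As any window is reached from any other in \<open>N\<close> steps with probability bounded
  below, \<open>T\<^sup>m h\<close> converges uniformly to the stationary mean of \<open>h\<close>.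
\<close>

section \<open>Sums over Boolean lists of fixed length\<close>

lemma finite_lists_length [simp, intro]: "finite {w::'b::finite list. length w = n}"
  using finite_lists_length_eq[of "UNIV :: 'b set" n] by simp

lemma sum_bool_lists_Suc:
  fixes g :: "bool list \<Rightarrow> 'b::comm_monoid_add"
  shows "(\<Sum>w | length w = Suc n. g w) = (\<Sum>w | length w = n. g (True # w) + g (False # w))"
proof -
  have "{w::bool list. length w = Suc n} = Cons True ` {w. length w = n} \<union> Cons False ` {w. length w = n}"
    by (auto simp: length_Suc_conv image_iff)
  then have "(\<Sum>w | length w = Suc n. g w)
      = (\<Sum>w\<in>Cons True ` {w. length w = n}. g w) + (\<Sum>w\<in>Cons False ` {w. length w = n}. g w)"
    by (simp only:) (rule sum.union_disjoint; auto)
  then show ?thesis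
    by (simp add: sum.reindex sum.distrib)
qed

lemma sum_bool_lists_rev:
  "(\<Sum>w | length w = n. g (rev w)) = (\<Sum>w | length w = n. g (w :: bool list))"
  by (rule sum.reindex_bij_witness[of _ rev rev]) auto

lemma sum_bool_lists_snoc:
  fixes g :: "bool list \<Rightarrow> 'b::comm_monoid_add"
  shows "(\<Sum>w | length w = Suc n. g w) = (\<Sum>w | length w = n. g (w @ [True]) + g (w @ [False]))"
proof -
  have "(\<Sum>w | length w = Suc n. g w) = (\<Sum>w | length w = Suc n. g (rev w))"
    by (rule sum_bool_lists_rev[symmetric])
  also have "\<dots> = (\<Sum>w | length w = n. g (rev w @ [True]) + g (rev w @ [False]))"
    by (simp add: sum_bool_lists_Suc)
  also have "\<dots> = (\<Sum>w | length w = n. g (w @ [True]) + g (w @ [False]))"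
    by (rule sum_bool_lists_rev[of "\<lambda>w. g (w @ [True]) + g (w @ [False])"])
  finally show ?thesis .
qed

lemma sum_binomial_Suc:
  fixes F :: "nat \<Rightarrow> real"
  shows "(\<Sum>j\<le>Suc n. real (Suc n choose j) * F j)
    = (\<Sum>j\<le>n. real (n choose j) * F (Suc j)) + (\<Sum>j\<le>n. real (n choose j) * F j)"
proof -
  have "(\<Sum>j\<le>Suc n. real (Suc n choose j) * F j)
      = F 0 + (\<Sum>j\<le>n. real (n choose j) * F (Suc j)) + (\<Sum>j\<le>n. real (n choose Suc j) * F (Suc j))"
    by (subst sum.atMost_Suc_shift) (simp add: sum.distrib algebra_simps)
  moreover have "F 0 + (\<Sum>j\<le>n. real (n choose Suc j) * F (Suc j)) = (\<Sum>j\<le>Suc n. real (n choose j) * F j)"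
    by (subst sum.atMost_Suc_shift) simp
  ultimately show ?thesis
    by simp
qed

lemma sum_bool_lists_count:
  fixes F :: "nat \<Rightarrow> real"
  shows "(\<Sum>w | length w = n. F (count_list w True)) = (\<Sum>j\<le>n. real (n choose j) * F j)"
proof (induction n arbitrary: F)
  case 0
  have "{w::bool list. w = []} = {[]}" by auto
  then show ?case by simp
next
  case (Suc n)
  have "(\<Sum>w | length w = Suc n. F (count_list w True))
      = (\<Sum>w | length w = n. F (Suc (count_list w True))) + (\<Sum>w | length w = n. F (count_list w True))"
    by (simp add: sum_bool_lists_Suc sum.distrib)
  then show ?case
    using Suc.IH[of "\<lambda>j. F (Suc j)"] Suc.IH[of F] by (simp add: sum_binomial_Suc del: sum.atMost_Suc)
qed

text \<open>By symmetry, among the lists with \<open>j\<close> entries \<open>True\<close> a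
  fraction \<open>j / n\<close> starts with \<open>True\<close>, so the first sign averages to
  \<open>2 * j / n - 1\<close>. This is the source of that factor in the numerator of the
  speed.\<close>

lemma sum_bool_lists_sign_hd_count:
  fixes F :: "nat \<Rightarrow> real"
  assumes "n > 0"
  shows "(\<Sum>w | length w = n. (if hd w then 1 else - 1) * F (count_list w True))
    = (\<Sum>j\<le>n. (2 * real j / real n - 1) * real (n choose j) * F j)"
proof -
  obtain m where n: "n = Suc m" using assms by (cases n) auto
  have "(\<Sum>w | length w = n. (if hd w then 1 else - 1) * F (count_list w True))
      = (\<Sum>w | length w = m. F (Suc (count_list w True))) - (\<Sum>w | length w = m. F (count_list w True))"
    by (simp add: n sum_bool_lists_Suc sum_subtractf)
  also have "\<dots> = (\<Sum>j\<le>m. real (m choose j) * F (Suc j)) - (\<Sum>j\<le>m. real (m choose j) * F j)"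
    using sum_bool_lists_count[of "\<lambda>j. F (Suc j)" m] sum_bool_lists_count[of F m] by simp
  also have "\<dots> = 2 * (\<Sum>j\<le>m. real (m choose j) * F (Suc j)) - (\<Sum>j\<le>n. real (n choose j) * F j)"
    by (simp add: n sum_binomial_Suc del: sum.atMost_Suc)
  \<comment> \<open>The absorption identity for binomial coefficients; the term \<open>j = 0\<close>
    on the right vanishes, so the index can be shifted.\<close>
  also have "2 * (\<Sum>j\<le>m. real (m choose j) * F (Suc j))
      = (\<Sum>j\<le>n. 2 * real j / real n * real (n choose j) * F j)"
  proof -
    have "2 * real (Suc j) / real n * real (n choose Suc j) = 2 * real (m choose j)" for j
      using arg_cong[where f = real, OF Suc_times_binomial[of j m]] n by (simp add: field_simps)
    then show ?thesis
      unfolding n by (subst sum.atMost_Suc_shift) (simp add: sum_distrib_left mult.assoc)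
  qed
  finally show ?thesis
    by (simp add: sum_subtractf algebra_simps)
qed

section \<open>Histories of jumps\<close>

primrec history :: "(nat \<Rightarrow> bool) \<Rightarrow> nat \<Rightarrow> bool list"
  where
    "history J 0 = []"
  | "history J (Suc n) = J n # history J n"

lemma length_history [simp]: "length (history J n) = n"
  by (induction n) auto

lemma history_cong: "(\<And>k. k < n \<Longrightarrow> J k = K k) \<Longrightarrow> history J n = history K n"
  by (induction n) auto

lemma history_eqD: "history J n = history K n \<Longrightarrow> k < n \<Longrightarrow> J k = K k"
  by (induction n) (auto simp: less_Suc_eq)

text \<open>For \<open>n < N\<close> truncated subtraction and \<open>take\<close> both keep all
  jumps, so no lower bound on \<open>n\<close> is called for. The induction generalises
  \<open>N\<close>, because stripping the newest jump leaves a window shorter by one.\<close>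

lemma recent_right_jumps_eq_count:
  "recent_right_jumps N x n = count_list (take N (history (\<lambda>k. jump x k = 1) n)) True"
proof (induction n arbitrary: N)
  case 0
  then show ?case by (simp add: recent_right_jumps_def)
next
  case (Suc n)
  show ?case
  proof (cases N)
    case 0
    then show ?thesis by (simp add: recent_right_jumps_def)
  next
    case (Suc m)
    have "{k \<in> {Suc n - N..<Suc n}. jump x k = 1}
        = (if jump x n = 1 then insert n else id) {k \<in> {n - m..<n}. jump x k = 1}"
      using Suc by (auto simp: less_Suc_eq)
    then show ?thesis
      using Suc.IH[of m] Suc by (simp add: recent_right_jumps_def)
  qed
qed

text \<open>
  The state is the whole history of jumps, newest first, so that a step is just a \<open>#\<close>; the window
  is its prefix of length \<open>N\<close>.
\<close>
locale window_chain =
  fixes N :: nat and r :: "nat \<Rightarrow> real" and \<epsilon> :: real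
  assumes N_pos: "N > 0" and eps_pos: "\<epsilon> > 0"
    and r_ge: "\<And>j. \<epsilon> \<le> r j" and r_le: "\<And>j. r j \<le> 1 - \<epsilon>"
begin

section \<open>The transition operator on functions of the history\<close>

definition right_prob :: "bool list \<Rightarrow> real"
  where "right_prob w = r (count_list (take N w) True)"

definition step :: "(bool list \<Rightarrow> real) \<Rightarrow> bool list \<Rightarrow> real"
  where "step h w = right_prob w * h (True # w) + (1 - right_prob w) * h (False # w)"

text \<open>Stands for functions on the finite space of windows. Nothing is demanded at histories
  shorter than \<open>N\<close>, which agree in their window only if they are equal.\<close>

definition windowed :: "(bool list \<Rightarrow> real) \<Rightarrow> bool"
  where "windowed h \<longleftrightarrow> (\<forall>u v. take N u = take N v \<longrightarrow> h u = h v)"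

lemma right_prob_bounds:
  "\<epsilon> \<le> right_prob w" "right_prob w \<le> 1 - \<epsilon>" "0 < right_prob w" "right_prob w < 1"
  using r_ge[of "count_list (take N w) True"] r_le[of "count_list (take N w) True"] eps_pos
  by (auto simp: right_prob_def)

lemma eps_le_1: "\<epsilon> \<le> 1"
  using r_ge[of 0] r_le[of 0] eps_pos by linarith

lemma step_mono:
  assumes "h (True # w) \<le> g (True # w)" "h (False # w) \<le> g (False # w)"
  shows "step h w \<le> step g w"
  unfolding step_def using assms right_prob_bounds[of w] by (intro add_mono mult_left_mono) auto

lemma step_const: "step (\<lambda>_. c) w = c"
  by (simp add: step_def algebra_simps)

lemma step_uminus: "step (\<lambda>w. - h w) = (\<lambda>w. - step h w)"
  by (auto simp: step_def algebra_simps)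

lemma windowed_append: "windowed h \<Longrightarrow> length v = N \<Longrightarrow> h (v @ w) = h v"
  by (simp add: windowed_def)

text \<open>\<open>step h\<close> reads the window through \<open>right_prob\<close>, which uses all
  of it, and through \<open>h\<close> after one more jump, which uses only its newest
  \<open>N - 1\<close> old entries.\<close>

lemma windowed_step:
  assumes "windowed h"
  shows "windowed (step h)"
  unfolding windowed_def
proof (intro allI impI)
  fix u v :: "bool list"
  assume uv: "take N u = take N v"
  have "take (N - 1) u = take (N - 1) v"
    using arg_cong[OF uv, of "take (N - 1)"] by (simp add: min_def)
  then have "take N (b # u) = take N (b # v)" for b
    using N_pos by (cases N) auto
  then have "h (b # u) = h (b # v)" for b
    using assms unfolding windowed_def by blast
  then show "step h u = step h v"
    by (simp add: step_def right_prob_def uv)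
qed

lemma windowed_funpow_step: "windowed h \<Longrightarrow> windowed ((step ^^ m) h)"
  by (induction m) (auto intro: windowed_step)

text \<open>A step only lengthens the history, so a bound valid on all histories of length at least
  \<open>n\<close> propagates. With \<open>n = N\<close> it covers the full windows, with
  \<open>n = 0\<close> all histories.\<close>

lemma step_le_const: "(\<And>w. n \<le> length w \<Longrightarrow> h w \<le> c) \<Longrightarrow> n \<le> length w \<Longrightarrow> step h w \<le> c"
  using step_mono[of h w "\<lambda>_. c"] by (simp add: step_const)

lemma funpow_step_le_const:
  "(\<And>w. n \<le> length w \<Longrightarrow> h w \<le> c) \<Longrightarrow> n \<le> length w \<Longrightarrow> (step ^^ m) h w \<le> c"
proof (induction m arbitrary: w)
  case (Suc m)
  then show ?case using step_le_const[of n "(step ^^ m) h" c w] by simp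
qed auto

lemma funpow_step_uminus: "(step ^^ m) (\<lambda>w. - h w) = (\<lambda>w. - (step ^^ m) h w)"
  by (induction m) (auto simp: step_uminus)

lemma funpow_step_ge_const:
  assumes "\<And>w. n \<le> length w \<Longrightarrow> c \<le> h w" "n \<le> length w"
  shows "c \<le> (step ^^ m) h w"
  using funpow_step_le_const[of n "\<lambda>w. - h w" "- c" w m] assms by (simp add: funpow_step_uminus)

lemma abs_funpow_step_le:
  assumes "\<And>w. \<bar>h w\<bar> \<le> c"
  shows "\<bar>(step ^^ m) h w\<bar> \<le> c"
  using funpow_step_le_const[of 0 h c w m] funpow_step_ge_const[of 0 "- c" h w m] assms
  by (auto simp: abs_le_iff minus_le_iff)

text \<open>Doeblin's minorisation: the jumps recorded in \<open>v\<close> occur with probability at least \<open>\<epsilon> ^ m\<close>.\<close>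
lemma funpow_step_minorization:
  assumes "\<And>w. n \<le> length w \<Longrightarrow> h w \<le> c" "length v = m" "n \<le> length w"
  shows "(step ^^ m) h w \<le> c - \<epsilon> ^ m * (c - h (v @ w))"
  using assms(2,3)
proof (induction m arbitrary: v w)
  case (Suc m)
  \<comment> \<open>Histories are newest first, so the earliest jump of \<open>v\<close> is its last
    entry, and the outermost \<open>step\<close> makes that jump.\<close>
  obtain u b where v: "v = u @ [b]" "length u = m"
    using Suc.prems(1) by (cases v rule: rev_exhaust) auto
  define d where "d = \<epsilon> ^ m * (c - h (v @ w))"
  have d0: "d \<ge> 0"
    unfolding d_def using assms(1)[of "v @ w"] Suc.prems eps_pos by simp
  have "(step ^^ m) h (b # w) \<le> c - \<epsilon> ^ m * (c - h (u @ b # w))"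
    using Suc.IH[of u "b # w"] v Suc.prems by simp
  then have b: "(step ^^ m) h (b # w) \<le> c - d"
    by (simp add: d_def v)
  have nb: "(step ^^ m) h ((\<not> b) # w) \<le> c"
    using funpow_step_le_const[of n h c "(\<not> b) # w" m] assms(1) Suc.prems by simp
  define q where "q = (if b then right_prob w else 1 - right_prob w)"
  have q: "\<epsilon> \<le> q" "q \<le> 1"
    using right_prob_bounds[of w] by (auto simp: q_def)
  have "(step ^^ Suc m) h w = q * (step ^^ m) h (b # w) + (1 - q) * (step ^^ m) h ((\<not> b) # w)"
    by (cases b) (simp_all add: step_def q_def)
  also have "\<dots> \<le> q * (c - d) + (1 - q) * c"
    using b nb q eps_pos by (intro add_mono mult_left_mono) auto
  also have "\<dots> = c - q * d" by (simp add: algebra_simps)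
  also have "\<dots> \<le> c - \<epsilon> * d" using q d0 by (simp add: mult_right_mono)
  finally show ?case by (simp add: d_def mult.assoc)
qed simp

section \<open>Contraction of the oscillation over full windows\<close>

definition osc_le :: "(bool list \<Rightarrow> real) \<Rightarrow> real \<Rightarrow> bool"
  where "osc_le h D \<longleftrightarrow> (\<forall>u v. N \<le> length u \<longrightarrow> N \<le> length v \<longrightarrow> h u - h v \<le> D)"

text \<open>From any start, \<open>N\<close> steps fill the window with a minimiser of
  \<open>h\<close> with probability at least \<open>\<epsilon> ^ N\<close>. This pulls the maximum
  down by that fraction of the oscillation, while the minimum cannot drop.\<close>

lemma osc_le_contraction:
  assumes h: "windowed h" and D: "osc_le h D"
  shows "osc_le ((step ^^ N) h) ((1 - \<epsilon> ^ N) * D)"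
  unfolding osc_le_def
proof (intro allI impI)
  fix u v :: "bool list"
  assume u: "N \<le> length u" and v: "N \<le> length v"
  let ?L = "{w::bool list. length w = N}"
  define a where "a = Min (h ` ?L)"
  define c where "c = Max (h ` ?L)"
  have "a \<in> h ` ?L"
    unfolding a_def by (rule Min_in) (auto simp: Ex_list_of_length)
  moreover have "c \<in> h ` ?L"
    unfolding c_def by (rule Max_in) (auto simp: Ex_list_of_length)
  ultimately obtain wa wc where wa: "length wa = N" "h wa = a" and wc: "length wc = N" "h wc = c"
    by auto
  \<comment> \<open>The extrema over the finitely many windows bound \<open>h\<close> on every
    history that contains a full window.\<close>
  have cut: "h w = h (take N w)" for w
    using h unfolding windowed_def by (metis take_take min.idem)
  have bounds: "h w \<le> c" "a \<le> h w" if "N \<le> length w" for w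
    using that cut[of w] by (auto simp: a_def c_def)
  have "(step ^^ N) h u \<le> c - \<epsilon> ^ N * (c - h (wa @ u))"
    using bounds(1) wa(1) u by (rule funpow_step_minorization)
  then have "(step ^^ N) h u \<le> c - \<epsilon> ^ N * (c - a)"
    using windowed_append[OF h wa(1)] wa(2) by simp
  moreover have "a \<le> (step ^^ N) h v"
    using bounds(2) v by (rule funpow_step_ge_const)
  ultimately have "(step ^^ N) h u - (step ^^ N) h v \<le> (1 - \<epsilon> ^ N) * (c - a)"
    by (simp add: algebra_simps)
  also have "\<dots> \<le> (1 - \<epsilon> ^ N) * D"
    using D wa wc eps_pos eps_le_1 unfolding osc_le_def
    by (intro mult_left_mono) (auto simp: power_le_one)
  finally show "(step ^^ N) h u - (step ^^ N) h v \<le> (1 - \<epsilon> ^ N) * D" .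
qed

lemma osc_le_funpow:
  assumes "windowed h" "osc_le h D"
  shows "osc_le ((step ^^ (N * k)) h) ((1 - \<epsilon> ^ N) ^ k * D)"
proof (induction k)
  case (Suc k)
  have "osc_le ((step ^^ N) ((step ^^ (N * k)) h)) ((1 - \<epsilon> ^ N) * ((1 - \<epsilon> ^ N) ^ k * D))"
    using windowed_funpow_step[OF assms(1)] Suc by (rule osc_le_contraction)
  then show ?case by (simp add: funpow_add mult.assoc)
qed (use assms in simp)

section \<open>The stationary law of the window\<close>

definition weight :: "nat \<Rightarrow> real"
  where "weight j = 1 / (1 - r j) * (\<Prod>m<j. r m / (1 - r m))"

lemma weight_pos: "weight j > 0"
proof -
  have "0 < r m" "r m < 1" for m
    using r_ge[of m] r_le[of m] eps_pos by linarith+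
  then show ?thesis by (auto simp: weight_def intro!: divide_pos_pos prod_pos)
qed

text \<open>This recursion fixes \<open>weight\<close> up to a factor. The choice
  \<open>weight 0 = 1 / (1 - r 0)\<close> makes the prefactors \<open>1 / (1 - p i)\<close> of the
  formula appear directly.\<close>

lemma weight_balance: "weight (Suc j) * (1 - r (Suc j)) = weight j * r j"
proof -
  have "r m < 1" for m using r_le[of m] eps_pos by linarith
  then have "1 - r m \<noteq> 0" for m by (simp add: less_imp_neq[THEN not_sym])
  then show ?thesis by (simp add: weight_def)
qed

definition stat_sum :: "(bool list \<Rightarrow> real) \<Rightarrow> real"
  where "stat_sum h = (\<Sum>w | length w = N. weight (count_list w True) * h w)"

text \<open>A window \<open>b # w\<close> is entered from \<open>w @ [True]\<close> and
  \<open>w @ [False]\<close>, whose counts differ by one. Source windows are therefore split by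
  their oldest jump and target windows by their newest; the balance recursion makes the mass
  entering each target equal to its weight.\<close>

lemma stat_sum_step:
  assumes h: "windowed h"
  shows "stat_sum (step h) = stat_sum h"
proof -
  obtain m where m: "N = Suc m" using N_pos by (cases N) auto
  let ?c = "\<lambda>w. count_list w True"
  have stat: "stat_sum g = (\<Sum>w | length w = Suc m. weight (?c w) * g w)" for g
    unfolding stat_sum_def unfolding m ..
  have window: "take N (w @ [b]) = w @ [b]" if "length w = m" for w :: "bool list" and b
    using that m by simp
  have cut: "h (b # w @ [b']) = h (b # w)" if "length w = m" for b b' w
    using windowed_append[OF h, of "b # w" "[b']"] that m by simp
  have "stat_sum (step h) = (\<Sum>w | length w = m.
      (weight (Suc (?c w)) * r (Suc (?c w)) + weight (?c w) * r (?c w)) * h (True # w)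
    + (weight (Suc (?c w)) * (1 - r (Suc (?c w))) + weight (?c w) * (1 - r (?c w))) * h (False # w))"
    unfolding stat sum_bool_lists_snoc
    by (intro sum.cong refl) (simp add: step_def right_prob_def cut window algebra_simps del: take_append)
  also have "\<dots> = (\<Sum>w | length w = m. weight (Suc (?c w)) * h (True # w) + weight (?c w) * h (False # w))"
  proof (intro sum.cong refl)
    fix w :: "bool list"
    have "weight (Suc (?c w)) * r (Suc (?c w)) + weight (?c w) * r (?c w) = weight (Suc (?c w))"
      "weight (Suc (?c w)) * (1 - r (Suc (?c w))) + weight (?c w) * (1 - r (?c w)) = weight (?c w)"
      using weight_balance[of "?c w"] by (simp_all add: algebra_simps)
    then show "(weight (Suc (?c w)) * r (Suc (?c w)) + weight (?c w) * r (?c w)) * h (True # w)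
      + (weight (Suc (?c w)) * (1 - r (Suc (?c w))) + weight (?c w) * (1 - r (?c w))) * h (False # w)
      = weight (Suc (?c w)) * h (True # w) + weight (?c w) * h (False # w)"
      by simp
  qed
  also have "\<dots> = stat_sum h"
    by (simp add: stat sum_bool_lists_Suc)
  finally show ?thesis .
qed

lemma stat_sum_funpow_step: "windowed h \<Longrightarrow> stat_sum ((step ^^ m) h) = stat_sum h"
  by (induction m) (auto simp: stat_sum_step windowed_funpow_step)

definition stat_mean :: "(bool list \<Rightarrow> real) \<Rightarrow> real"
  where "stat_mean h = stat_sum h / stat_sum (\<lambda>_. 1)"

lemma stat_sum_1_pos: "stat_sum (\<lambda>_. 1) > 0"
  unfolding stat_sum_def by (intro sum_pos) (auto simp: weight_pos Ex_list_of_length)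

lemma stat_mean_uminus: "stat_mean (\<lambda>w. - h w) = - stat_mean h"
  by (simp add: stat_mean_def stat_sum_def sum_negf)

lemma stat_mean_ge:
  assumes "\<And>w. length w = N \<Longrightarrow> c \<le> h w"
  shows "c \<le> stat_mean h"
proof -
  have "c * stat_sum (\<lambda>_. 1) \<le> stat_sum h"
    unfolding stat_sum_def sum_distrib_left
    using assms weight_pos by (intro sum_mono) (simp add: mult.commute[of c] mult_left_mono less_imp_le)
  then show ?thesis
    using stat_sum_1_pos by (simp add: stat_mean_def field_simps)
qed

lemma stat_mean_le: "(\<And>w. length w = N \<Longrightarrow> h w \<le> c) \<Longrightarrow> stat_mean h \<le> c"
  using stat_mean_ge[of "- c" "\<lambda>w. - h w"] by (simp add: stat_mean_uminus)

text \<open>The stationary mean is invariant under \<open>step\<close>, hence is an average of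
  values of \<open>(step ^^ m) h\<close>, which differ by at most \<open>D\<close>.\<close>

lemma funpow_step_near_stat_mean:
  assumes "windowed h" "osc_le ((step ^^ m) h) D" "N \<le> length w"
  shows "\<bar>(step ^^ m) h w - stat_mean h\<bar> \<le> D"
proof -
  let ?g = "(step ^^ m) h"
  have "?g w - D \<le> stat_mean ?g"
    by (rule stat_mean_ge) (use assms in \<open>auto simp: osc_le_def algebra_simps\<close>)
  moreover have "stat_mean ?g \<le> ?g w + D"
    by (rule stat_mean_le) (use assms in \<open>auto simp: osc_le_def algebra_simps\<close>)
  moreover have "stat_mean ?g = stat_mean h"
    by (simp add: stat_mean_def stat_sum_funpow_step assms(1))
  ultimately show ?thesis by linarith
qed

lemma funpow_step_close_to_stat_mean:
  assumes h: "windowed h" "\<And>w. \<bar>h w\<bar> \<le> 1" and e: "e > 0"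
  obtains m where "\<And>w. N \<le> length w \<Longrightarrow> \<bar>(step ^^ m) h w - stat_mean h\<bar> \<le> e"
proof -
  have "osc_le h 2"
    unfolding osc_le_def using h(2) by (smt (verit, best))
  then have osc: "osc_le ((step ^^ (N * k)) h) ((1 - \<epsilon> ^ N) ^ k * 2)" for k
    by (rule osc_le_funpow[OF h(1)])
  have "0 < \<epsilon> ^ N" "\<epsilon> ^ N \<le> 1"
    using eps_pos eps_le_1 by (auto simp: power_le_one)
  then have "(\<lambda>k. (1 - \<epsilon> ^ N) ^ k * 2) \<longlonglongrightarrow> 0"
    by (intro tendsto_mult_left_zero LIMSEQ_realpow_zero) auto
  then have "eventually (\<lambda>k. (1 - \<epsilon> ^ N) ^ k * 2 < e) sequentially"
    using e by (rule order_tendstoD)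
  then obtain k where "(1 - \<epsilon> ^ N) ^ k * 2 < e"
    by (auto simp: eventually_sequentially)
  then show ?thesis
    using funpow_step_near_stat_mean[OF h(1) osc[of k]] that[of "N * k"] by fastforce
qed

section \<open>The martingale and the time averages along one path\<close>

text \<open>Increments are recorded only once the history has length \<open>N\<close>: the first
  \<open>N\<close> jumps do not follow \<open>right_prob\<close>, so earlier increments need not be
  centered.\<close>

primrec mart :: "(bool list \<Rightarrow> real) \<Rightarrow> bool list \<Rightarrow> real"
  where
    "mart h [] = 0"
  | "mart h (b # w) = mart h w + (if N \<le> length w then h (b # w) - step h w else 0)"

lemma abs_step_le: "(\<And>w. \<bar>h w\<bar> \<le> 1) \<Longrightarrow> \<bar>step h w\<bar> \<le> 1"
  using abs_funpow_step_le[of h 1 1 w] by simp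

lemma abs_increment_le:
  assumes "\<And>w. \<bar>h w\<bar> \<le> 1"
  shows "\<bar>h v - step h w\<bar> \<le> 2"
  using abs_step_le[where h = h and w = w, OF assms] assms[of v] by linarith

lemma mart_near_sum:
  assumes "\<And>w. \<bar>h w\<bar> \<le> 1"
  shows "\<bar>(\<Sum>k<n. h (history J (Suc k)) - step h (history J k)) - mart h (history J n)\<bar> \<le> 2 * real (min n N)"
proof (induction n)
  case (Suc n)
  show ?case
    using Suc abs_increment_le[where h = h and v = "history J (Suc n)" and w = "history J n", OF assms]
    by (cases "N \<le> n") (auto simp: min_def split: if_splits)
qed simp

lemma average_step:
  assumes h: "\<And>w. \<bar>h w\<bar> \<le> 1"
    and mart: "(\<lambda>n. mart h (history J n) / real n) \<longlonglongrightarrow> 0"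
  shows "(\<lambda>n. (\<Sum>k<n. h (history J k)) / real n - (\<Sum>k<n. step h (history J k)) / real n) \<longlonglongrightarrow> 0"
proof -
  \<comment> \<open>Two bounded errors: at most \<open>2 * N\<close> from the increments left out of
    \<open>mart\<close>, and at most 2 from the endpoints when the sum is shifted by one time
    step.\<close>
  define R where "R n = (\<Sum>k<n. h (history J k)) - (\<Sum>k<n. step h (history J k)) - mart h (history J n)" for n
  have "\<bar>R n\<bar> \<le> 2 * real N + 2" for n
  proof -
    have "(\<Sum>k<n. h (history J (Suc k)) - h (history J k)) = h (history J n) - h (history J 0)"
      by (rule sum_lessThan_telescope)
    then have "R n = (\<Sum>k<n. h (history J (Suc k)) - step h (history J k)) - mart h (history J n)
        - h (history J n) + h (history J 0)"
      by (simp add: R_def sum_subtractf del: history.simps)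
    moreover have "\<bar>h (history J n)\<bar> \<le> 1" "\<bar>h (history J 0)\<bar> \<le> 1" by (rule h)+
    moreover have "2 * real (min n N) \<le> 2 * real N" by simp
    ultimately show ?thesis
      using mart_near_sum[where h = h and n = n and J = J, OF h] by linarith
  qed
  then have "eventually (\<lambda>n. norm (R n / real n) \<le> (2 * real N + 2) / real n) sequentially"
    by (intro always_eventually) (simp add: divide_right_mono)
  then have "(\<lambda>n. R n / real n) \<longlonglongrightarrow> 0"
    by (rule Lim_null_comparison) (rule lim_const_over_n)
  then have "(\<lambda>n. R n / real n + mart h (history J n) / real n) \<longlonglongrightarrow> 0 + 0"
    using mart by (rule tendsto_add)
  then show ?thesis
    by (simp add: R_def diff_divide_distrib)
qed

text \<open>A statement about a single path: randomness enters only through the assumption on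
  \<open>mart\<close>. That assumption equates the limits of the averages of \<open>h\<close> and
  \<open>(step ^^ m) h\<close>, and the latter function is nearly constant for suitable
  \<open>m\<close>.\<close>

lemma average_tendsto_stat_mean:
  assumes h: "windowed h" "\<And>w. \<bar>h w\<bar> \<le> 1"
    and mart: "\<And>m. (\<lambda>n. mart ((step ^^ m) h) (history J n) / real n) \<longlonglongrightarrow> 0"
  shows "(\<lambda>n. (\<Sum>k<n. h (history J k)) / real n) \<longlonglongrightarrow> stat_mean h"
proof -
  define A where "A m n = (\<Sum>k<n. (step ^^ m) h (history J k)) / real n" for m n
  define c where "c = stat_mean h"
  have bd: "\<bar>(step ^^ m) h w\<bar> \<le> 1" for m w
    using h(2) by (rule abs_funpow_step_le)
  have c: "\<bar>c\<bar> \<le> 1"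
    using stat_mean_le[of h 1] stat_mean_ge[of "- 1" h] h(2)
    by (auto simp: c_def abs_le_iff minus_le_iff)
  have diff: "(\<lambda>n. A 0 n - A m n) \<longlonglongrightarrow> 0" for m
  proof (induction m)
    case (Suc m)
    have "(\<lambda>n. A m n - A (Suc m) n) \<longlonglongrightarrow> 0"
      using average_step[OF bd mart, of m] by (simp add: A_def)
    from tendsto_add[OF Suc this] show ?case by simp
  qed simp
  have "(\<lambda>n. A 0 n) \<longlonglongrightarrow> c"
  proof (rule tendstoI)
    fix e :: real
    assume e: "e > 0"
    \<comment> \<open>The three thirds pay for the mixing error on full windows, for the initial
      short histories, and for exchanging \<open>h\<close> with
      \<open>(step ^^ m) h\<close>.\<close>
    then have "e / 3 > 0" by simp
    with h obtain m where m: "\<And>w. N \<le> length w \<Longrightarrow> \<bar>(step ^^ m) h w - c\<bar> \<le> e / 3"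
      using funpow_step_close_to_stat_mean unfolding c_def by metis
    \<comment> \<open>Each of the first \<open>N\<close> histories may lack a full window; there
      only the trivial bound 2 is available.\<close>
    have sum: "\<bar>(\<Sum>k<n. (step ^^ m) h (history J k) - c)\<bar> \<le> 2 * real N + real n * (e / 3)" for n
    proof -
      have "\<bar>(\<Sum>k<n. (step ^^ m) h (history J k) - c)\<bar> \<le> 2 * real (min n N) + real n * (e / 3)"
      proof (induction n)
        case (Suc n)
        have e_Suc: "real (Suc n) * (e / 3) = real n * (e / 3) + e / 3"
          by (simp add: distrib_right)
        show ?case
        proof (cases "N \<le> n")
          case True
          then have "real (min (Suc n) N) = real N" "real (min n N) = real N"
            by auto
          then show ?thesis
            using Suc m[of "history J n"] True e_Suc unfolding sum.lessThan_Suc length_history by linarith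
        next
          case False
          then have mins: "real (min (Suc n) N) = real n + 1" "real (min n N) = real n"
            by auto
          have "\<bar>(step ^^ m) h (history J n) - c\<bar> \<le> 2"
            using bd[of m "history J n"] c by linarith
          moreover have "0 \<le> e / 3" using e by simp
          ultimately show ?thesis
            using Suc abs_triangle_ineq[of "\<Sum>k<n. (step ^^ m) h (history J k) - c" "(step ^^ m) h (history J n) - c"]
            unfolding sum.lessThan_Suc mins e_Suc by argo
        qed
      qed simp
      then show ?thesis by (simp add: min_def split: if_splits)
    qed
    have near: "\<bar>A m n - c\<bar> \<le> 2 * real N / real n + e / 3" if "n > 0" for n
    proof -
      have "A m n - c = (\<Sum>k<n. (step ^^ m) h (history J k) - c) / real n"
        using that by (simp add: A_def sum_subtractf field_simps)
      then have "\<bar>A m n - c\<bar> = \<bar>(\<Sum>k<n. (step ^^ m) h (history J k) - c)\<bar> / real n"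
        by simp
      also have "\<dots> \<le> (2 * real N + real n * (e / 3)) / real n"
        using sum by (intro divide_right_mono) auto
      finally show ?thesis using that by (simp add: add_divide_distrib)
    qed
    have "(\<lambda>n. 2 * real N / real n) \<longlonglongrightarrow> 0"
      by (rule lim_const_over_n)
    then have "eventually (\<lambda>n. 2 * real N / real n < e / 3) sequentially"
      using e by (intro order_tendstoD) auto
    moreover have "eventually (\<lambda>n. \<bar>A 0 n - A m n\<bar> < e / 3) sequentially"
      using tendstoD[OF diff[of m], of "e / 3"] e by (simp add: dist_real_def)
    ultimately show "eventually (\<lambda>n. dist (A 0 n) c < e) sequentially"
      using eventually_gt_at_top[of 0]
    proof eventually_elim
      case (elim n)
      then show ?case using near[of n] unfolding dist_real_def by linarith
    qed
  qed
  then show ?thesis by (simp add: A_def c_def)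
qed

section \<open>Second and fourth moments of one martingale step\<close>

lemma centered_increment_moments:
  fixes q a d d' :: real
  assumes q: "0 \<le> q" "q \<le> 1" and centered: "q * d + (1 - q) * d' = 0"
    and d: "\<bar>d\<bar> \<le> 2" "\<bar>d'\<bar> \<le> 2"
  shows "q * (a + d)\<^sup>2 + (1 - q) * (a + d')\<^sup>2 \<le> a\<^sup>2 + 4"
    and "q * (a + d) ^ 4 + (1 - q) * (a + d') ^ 4 \<le> a ^ 4 + 32 * a\<^sup>2 + 48"
proof -
  have sq: "x\<^sup>2 \<le> 4" if "\<bar>x\<bar> \<le> 2" for x :: real
    using power_mono[OF that, of 2] by simp
  have average: "q * x + (1 - q) * y \<le> z" if "x \<le> z" "y \<le> z" for x y z
    using q that convex_bound_le[of x z y q "1 - q"] by simp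
  \<comment> \<open>The terms linear in the increment vanish by centering; the others are averages
    of bounded quantities.\<close>
  have "q * (a + d)\<^sup>2 + (1 - q) * (a + d')\<^sup>2
      = a\<^sup>2 + 2 * a * (q * d + (1 - q) * d') + (q * d\<^sup>2 + (1 - q) * d'\<^sup>2)"
    by (simp add: power2_eq_square algebra_simps)
  then show "q * (a + d)\<^sup>2 + (1 - q) * (a + d')\<^sup>2 \<le> a\<^sup>2 + 4"
    using average[of "d\<^sup>2" 4 "d'\<^sup>2"] sq d centered by simp
  \<comment> \<open>The cubic term is absorbed into its neighbours by \<open>2 * (a * x)\<close>
    being at most the sum of the squares, multiplied by twice the square of
    \<open>x\<close>.\<close>
  have rest: "6 * a\<^sup>2 * x\<^sup>2 + 4 * a * x ^ 3 + x ^ 4 \<le> 32 * a\<^sup>2 + 48" if "\<bar>x\<bar> \<le> 2" for x :: real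
  proof -
    have x2: "x\<^sup>2 \<le> 4" "0 \<le> x\<^sup>2" using sq that by auto
    have "2 * (a * x) \<le> a\<^sup>2 + x\<^sup>2"
      using sum_squares_bound[of a x] by simp
    then have "4 * (a * x) * x\<^sup>2 \<le> 2 * (a\<^sup>2 + x\<^sup>2) * x\<^sup>2"
      using x2 by (intro mult_right_mono) auto
    then have "6 * a\<^sup>2 * x\<^sup>2 + 4 * a * x ^ 3 + x ^ 4 \<le> 8 * a\<^sup>2 * x\<^sup>2 + 3 * (x\<^sup>2)\<^sup>2"
      by (simp add: power2_eq_square power3_eq_cube power4_eq_xxxx algebra_simps)
    also have "\<dots> \<le> 8 * a\<^sup>2 * 4 + 3 * 4\<^sup>2"
      using x2 by (intro add_mono mult_left_mono power_mono) auto
    finally show ?thesis by simp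
  qed
  have "q * (a + d) ^ 4 + (1 - q) * (a + d') ^ 4
      = a ^ 4 + 4 * a ^ 3 * (q * d + (1 - q) * d')
      + (q * (6 * a\<^sup>2 * d\<^sup>2 + 4 * a * d ^ 3 + d ^ 4) + (1 - q) * (6 * a\<^sup>2 * d'\<^sup>2 + 4 * a * d' ^ 3 + d' ^ 4))"
    by (simp add: power2_eq_square power3_eq_cube power4_eq_xxxx algebra_simps)
  then show "q * (a + d) ^ 4 + (1 - q) * (a + d') ^ 4 \<le> a ^ 4 + 32 * a\<^sup>2 + 48"
    using average[OF rest rest] d centered by simp
qed

lemma step_mart_moments:
  assumes h: "\<And>w. \<bar>h w\<bar> \<le> 1" and w: "N \<le> length w"
  shows "step (\<lambda>v. (mart h v)\<^sup>2) w \<le> (mart h w)\<^sup>2 + 4"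
    and "step (\<lambda>v. mart h v ^ 4) w \<le> mart h w ^ 4 + 32 * (mart h w)\<^sup>2 + 48"
proof -
  let ?d = "\<lambda>b. h (b # w) - step h w"
  have c: "right_prob w * ?d True + (1 - right_prob w) * ?d False = 0"
    by (simp add: step_def algebra_simps)
  have q: "0 \<le> right_prob w" "right_prob w \<le> 1"
    using right_prob_bounds[of w] by auto
  have d: "\<bar>?d b\<bar> \<le> 2" for b
    by (rule abs_increment_le) (rule h)
  note * = centered_increment_moments[OF q c, of "mart h w"]
  show "step (\<lambda>v. (mart h v)\<^sup>2) w \<le> (mart h w)\<^sup>2 + 4"
    using *(1) d w unfolding step_def[of "\<lambda>v. (mart h v)\<^sup>2"] by simp
  show "step (\<lambda>v. mart h v ^ 4) w \<le> mart h w ^ 4 + 32 * (mart h w)\<^sup>2 + 48"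
    using *(2) d w unfolding step_def[of "\<lambda>v. mart h v ^ 4"] by simp
qed

lemma mart_short: "length w \<le> N \<Longrightarrow> mart h w = 0"
  by (induction w) auto

end

section \<open>Almost sure convergence from fourth moments\<close>

text \<open>The expectations of the fourth powers of \<open>Z n / n\<close> are dominated by
  \<open>c / n^2\<close>, so their series has finite expectation. It then converges almost surely,
  and its terms tend to 0.\<close>

lemma (in prob_space) AE_tendsto_0_of_fourth_moment:
  fixes Z :: "nat \<Rightarrow> 'a \<Rightarrow> real"
  assumes [measurable]: "\<And>n. Z n \<in> borel_measurable M"
    and int: "\<And>n. integrable M (\<lambda>\<omega>. Z n \<omega> ^ 4)"
    and bound: "\<And>n. expectation (\<lambda>\<omega>. Z n \<omega> ^ 4) \<le> c * (real n)\<^sup>2"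
  shows "AE \<omega> in M. (\<lambda>n. Z n \<omega> / real n) \<longlonglongrightarrow> 0"
proof -
  have "(\<integral>\<^sup>+\<omega>. (\<Sum>n. ennreal ((Z n \<omega> / real n) ^ 4)) \<partial>M)
      = (\<Sum>n. \<integral>\<^sup>+\<omega>. ennreal ((Z n \<omega> / real n) ^ 4) \<partial>M)"
    by (intro nn_integral_suminf) auto
  also have "\<dots> \<le> (\<Sum>n. ennreal (c * inverse ((real n)\<^sup>2)))"
  proof (intro suminf_le summableI)
    fix n
    have "(\<integral>\<^sup>+\<omega>. ennreal ((Z n \<omega> / real n) ^ 4) \<partial>M) = ennreal (expectation (\<lambda>\<omega>. Z n \<omega> ^ 4 / real n ^ 4))"
      unfolding power_divide using int by (intro nn_integral_eq_integral) auto
    also have "\<dots> \<le> ennreal (c * inverse ((real n)\<^sup>2))"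
    proof (rule ennreal_leI)
      have "expectation (\<lambda>\<omega>. Z n \<omega> ^ 4 / real n ^ 4) \<le> c * (real n)\<^sup>2 / real n ^ 4"
        using divide_right_mono[OF bound[of n], of "real n ^ 4"] by simp
      then show "expectation (\<lambda>\<omega>. Z n \<omega> ^ 4 / real n ^ 4) \<le> c * inverse ((real n)\<^sup>2)"
        \<comment> \<open>At \<open>n = 0\<close> both sides are 0, since division by zero gives
          0.\<close>
        by (cases "n = 0") (auto simp: field_simps power2_eq_square power4_eq_xxxx)
    qed
    finally show "(\<integral>\<^sup>+\<omega>. ennreal ((Z n \<omega> / real n) ^ 4) \<partial>M) \<le> ennreal (c * inverse ((real n)\<^sup>2))" .
  qed
  also have "\<dots> < \<infinity>"
  proof -
    have "0 \<le> expectation (\<lambda>\<omega>. Z 1 \<omega> ^ 4)" by simp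
    also have "\<dots> \<le> c" using bound[of 1] by simp
    finally have "0 \<le> c" .
    moreover have "summable (\<lambda>n. c * inverse ((real n)\<^sup>2))"
      by (intro summable_mult inverse_power_summable) auto
    ultimately have "(\<Sum>n. ennreal (c * inverse ((real n)\<^sup>2))) = ennreal (\<Sum>n. c * inverse ((real n)\<^sup>2))"
      by (intro suminf_ennreal2) auto
    then show ?thesis by simp
  qed
  finally have "(\<integral>\<^sup>+\<omega>. (\<Sum>n. ennreal ((Z n \<omega> / real n) ^ 4)) \<partial>M) \<noteq> \<infinity>" by simp
  then have "AE \<omega> in M. (\<Sum>n. ennreal ((Z n \<omega> / real n) ^ 4)) \<noteq> \<infinity>"
    by (intro nn_integral_noteq_infinite) auto
  then show ?thesis
  proof eventually_elim
    case (elim \<omega>)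
    then have "summable (\<lambda>n. (Z n \<omega> / real n) ^ 4)"
      by (intro summable_suminf_not_top) auto
    then have "(\<lambda>n. (Z n \<omega> / real n) ^ 4) \<longlonglongrightarrow> 0" by (rule summable_LIMSEQ_zero)
    then have "(\<lambda>n. root 4 ((Z n \<omega> / real n) ^ 4)) \<longlonglongrightarrow> root 4 0" by (rule tendsto_real_root)
    moreover have "(\<lambda>n. root 4 ((Z n \<omega> / real n) ^ 4)) = (\<lambda>n. \<bar>Z n \<omega> / real n\<bar>)"
    proof
      show "root 4 ((Z n \<omega> / real n) ^ 4) = \<bar>Z n \<omega> / real n\<bar>" for n
        using root_abs_power[of 4 "Z n \<omega> / real n"] by simp
    qed
    ultimately have "(\<lambda>n. \<bar>Z n \<omega> / real n\<bar>) \<longlonglongrightarrow> 0"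
      by (simp only: real_root_zero)
    then show ?case by (rule tendsto_rabs_zero_cancel)
  qed
qed

section \<open>The law of the jump history of the walk\<close>

text \<open>The thresholds are absorbed into \<open>r\<close>, the jump probability as a function of
  the number of recent right jumps.\<close>

locale excited_walk = recent_history_walk P X x0 N l \<theta> p + window_chain N r \<epsilon>
  for P :: "'a measure" and X x0 N l \<theta> p r \<epsilon> +
  assumes threshold_cover: "\<And>j. j \<le> N \<Longrightarrow> \<exists>i\<le>l. j \<in> {\<theta> i..\<theta> (i + 1) - 1} \<and> r j = p i"
begin

definition H :: "nat \<Rightarrow> 'a \<Rightarrow> bool list"
  where "H n \<omega> = history (\<lambda>k. jump (\<lambda>j. X j \<omega>) k = 1) n"

lemma length_H [simp]: "length (H n \<omega>) = n"
  by (simp add: H_def)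

lemma H_Suc: "H (Suc n) \<omega> = (jump (\<lambda>j. X j \<omega>) n = 1) # H n \<omega>"
  by (simp add: H_def)

lemma measurable_H [measurable]: "H n \<in> measurable P (count_space UNIV)"
proof (induction n)
  case 0
  then show ?case by (simp add: H_def)
next
  case (Suc n)
  note [measurable] = random_walk Suc
  have [measurable]: "Measurable.pred P (\<lambda>\<omega>. X (Suc n) \<omega> - X n \<omega> = 1)"
    by measurable
  show ?case
    unfolding H_Suc jump_def by measurable
qed

text \<open>\<open>H n\<close> takes finitely many values, so integrability and expectations of its
  functions reduce to finite sums over lists.\<close>

lemma history_function_eq_sum:
  assumes "\<omega> \<in> space P"
  shows "F (H n \<omega>) = (\<Sum>y | length y = n. F y * indicator {\<omega> \<in> space P. H n \<omega> = y} \<omega> :: real)"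
  using assms by (subst sum.remove[of _ "H n \<omega>"]) (auto intro!: sum.neutral)

lemma integrable_history_function [simp, intro]:
  "integrable P (\<lambda>\<omega>. F (H n \<omega>) :: real)"
proof -
  have "integrable P (\<lambda>\<omega>. \<Sum>y | length y = n. F y * indicator {\<omega> \<in> space P. H n \<omega> = y} \<omega>)"
    by (intro Bochner_Integration.integrable_sum integrable_mult_right integrable_real_indicator)
      (auto simp: emeasure_eq_measure)
  then show ?thesis
    by (subst Bochner_Integration.integrable_cong[OF refl history_function_eq_sum])
qed

lemma expectation_history:
  "expectation (\<lambda>\<omega>. F (H n \<omega>)) = (\<Sum>y | length y = n. \<P>(\<omega> in P. H n \<omega> = y) * F y)"
proof -
  have "expectation (\<lambda>\<omega>. F (H n \<omega>))
      = (\<Sum>y | length y = n. expectation (\<lambda>\<omega>. F y * indicator {\<omega> \<in> space P. H n \<omega> = y} \<omega>))"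
    by (subst Bochner_Integration.integral_cong[OF refl history_function_eq_sum], assumption,
        rule Bochner_Integration.integral_sum)
      (intro integrable_mult_right integrable_real_indicator; auto simp: emeasure_eq_measure)
  then show ?thesis by (simp add: Int_absorb2 mult.commute)
qed

lemma AE_admissible_path: "AE \<omega> in P. X 0 \<omega> = x0 \<and> (\<forall>n. jump (\<lambda>k. X k \<omega>) n \<in> {1, - 1})"
  using start unit_jumps by (simp add: AE_all_countable)

text \<open>A jump that is not 1 must be -1, so the starting point and the Boolean history determine
  the path.\<close>

lemma path_eq_of_history_eq:
  assumes "x 0 = z 0" "\<And>k. jump x k \<in> {1, - 1}" "\<And>k. jump z k \<in> {1, - 1}"
    and eq: "history (\<lambda>k. jump x k = 1) n = history (\<lambda>k. jump z k = 1) n" and "k \<le> n"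
  shows "x k = z k"
  using \<open>k \<le> n\<close>
proof (induction k)
  case (Suc k)
  have "jump x k = jump z k"
    using history_eqD[OF eq, of k] Suc.prems assms(2,3)[of k] by auto
  then show ?case
    using Suc by (simp add: jump_def)
qed (use assms in simp)

lemma history_eq_of_path_eq:
  "(\<And>k. k \<le> n \<Longrightarrow> x k = z k) \<Longrightarrow> history (\<lambda>k. jump x k = 1) n = history (\<lambda>k. jump z k = 1) n"
  by (intro history_cong) (simp add: jump_def)

text \<open>The walk is specified by conditioning on positions, the chain by jumps. Almost surely
  both describe the same event. Histories of probability 0 are treated apart, because the
  specification is silent about them.\<close>

lemma transition_True:
  assumes n: "N \<le> n"
  shows "\<P>(\<omega> in P. H (Suc n) \<omega> = True # y) = right_prob y * \<P>(\<omega> in P. H n \<omega> = y)"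
proof (cases "\<P>(\<omega> in P. H n \<omega> = y) = 0")
  case True
  have "\<P>(\<omega> in P. H (Suc n) \<omega> = True # y) \<le> \<P>(\<omega> in P. H n \<omega> = y)"
    by (intro finite_measure_mono) (auto simp: H_Suc)
  then show ?thesis
    using True by (simp add: measure_le_0_iff)
next
  case False
  let ?good = "\<lambda>\<omega>. X 0 \<omega> = x0 \<and> (\<forall>n. jump (\<lambda>k. X k \<omega>) n \<in> {1, - 1})"
  have "\<not> (AE \<omega> in P. H n \<omega> \<noteq> y)"
    using False by (subst (asm) prob_eq_0) auto
  moreover have "AE \<omega> in P. H n \<omega> \<noteq> y" if "\<And>\<omega>. ?good \<omega> \<Longrightarrow> H n \<omega> \<noteq> y"
    using AE_admissible_path by (rule eventually_mono) (use that in blast)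
  \<comment> \<open>An event of positive probability meets the almost sure set of admissible paths.
    A sample point in both supplies the positions \<open>x\<close> to condition on.\<close>
  ultimately obtain \<omega>0 where good0: "?good \<omega>0" and y: "H n \<omega>0 = y"
    by blast
  define x where "x k = X k \<omega>0" for k
  have path: "H n \<omega> = y \<longleftrightarrow> (\<forall>k\<le>n. X k \<omega> = x k)" if "?good \<omega>" for \<omega>
  proof -
    have "X 0 \<omega> = x 0" "jump (\<lambda>k. X k \<omega>) k \<in> {1, - 1}" "jump x k \<in> {1, - 1}" for k
      using that good0 by (simp_all add: x_def[abs_def])
    moreover have "y = history (\<lambda>k. jump x k = 1) n"
      unfolding y[symmetric] H_def x_def ..
    ultimately show ?thesis
      unfolding H_def
      using path_eq_of_history_eq[of "\<lambda>k. X k \<omega>" x n] history_eq_of_path_eq[of n "\<lambda>k. X k \<omega>" x]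
      by metis
  qed
  have AE_path: "AE \<omega> in P. H n \<omega> = y \<longleftrightarrow> (\<forall>k\<le>n. X k \<omega> = x k)"
    using AE_admissible_path by (rule eventually_mono) (rule path)
  note [measurable] = random_walk
  have past: "\<P>(\<omega> in P. \<forall>k\<le>n. X k \<omega> = x k) = \<P>(\<omega> in P. H n \<omega> = y)"
    by (intro measure_eq_AE eventually_mono[OF AE_path]) auto
  have [measurable]: "Measurable.pred P (\<lambda>\<omega>. jump (\<lambda>k. X k \<omega>) n = 1)"
    unfolding jump_def by measurable
  have joint: "\<P>(\<omega> in P. jump (\<lambda>k. X k \<omega>) n = 1 \<and> (\<forall>k\<le>n. X k \<omega> = x k))
      = \<P>(\<omega> in P. H (Suc n) \<omega> = True # y)"
    by (intro measure_eq_AE eventually_mono[OF AE_path]) (auto simp: H_Suc)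
  have recent: "recent_right_jumps N x n = count_list (take N y) True"
    using y by (simp add: recent_right_jumps_eq_count H_def x_def[abs_def])
  have "count_list (take N y) True \<le> N"
    using count_le_length[of "take N y" True] by simp
  then obtain i where i: "i \<le> l" "count_list (take N y) True \<in> {\<theta> i..\<theta> (i + 1) - 1}" "right_prob y = p i"
    using threshold_cover unfolding right_prob_def by blast
  have "\<P>(\<omega> in P. \<forall>k\<le>n. X k \<omega> = x k) > 0"
    using False past by (simp add: zero_less_measure_iff)
  then have "\<P>(\<omega> in P. jump (\<lambda>k. X k \<omega>) n = 1 \<bar> \<forall>k\<le>n. X k \<omega> = x k) = right_prob y"
    using transition_prob[OF n _ i(1)] i recent by simp
  then show ?thesis
    using False by (simp add: cond_prob_def past joint field_simps)
qed

lemma transition_False: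
  assumes n: "N \<le> n"
  shows "\<P>(\<omega> in P. H (Suc n) \<omega> = False # y) = (1 - right_prob y) * \<P>(\<omega> in P. H n \<omega> = y)"
proof -
  have "\<P>(\<omega> in P. H n \<omega> = y)
      = prob ({\<omega> \<in> space P. H (Suc n) \<omega> = True # y} \<union> {\<omega> \<in> space P. H (Suc n) \<omega> = False # y})"
    by (rule arg_cong[where f = prob]) (auto simp: H_Suc)
  also have "\<dots> = \<P>(\<omega> in P. H (Suc n) \<omega> = True # y) + \<P>(\<omega> in P. H (Suc n) \<omega> = False # y)"
    by (intro finite_measure_Union) auto
  finally show ?thesis
    using transition_True[OF n, of y] by (simp add: algebra_simps)
qed

text \<open>The Markov property in integrated form, obtained by splitting the history at its newest
  jump.\<close>

lemma expectation_Suc: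
  assumes "N \<le> n"
  shows "expectation (\<lambda>\<omega>. F (H (Suc n) \<omega>)) = expectation (\<lambda>\<omega>. step F (H n \<omega>))"
  unfolding expectation_history sum_bool_lists_Suc
  by (intro sum.cong refl)
    (simp add: transition_True[OF assms] transition_False[OF assms] step_def algebra_simps)

text \<open>Both bounds go into one induction because the fourth moment grows by a multiple of the
  second. The constant 100 suffices: the growth \<open>32 * (4 * n) + 48\<close> is at most
  \<open>200 * n + 100\<close>.\<close>

lemma mart_moments:
  assumes h: "\<And>w. \<bar>h w\<bar> \<le> 1"
  shows "expectation (\<lambda>\<omega>. (mart h (H n \<omega>))\<^sup>2) \<le> 4 * real n
    \<and> expectation (\<lambda>\<omega>. mart h (H n \<omega>) ^ 4) \<le> 100 * (real n)\<^sup>2"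
proof (induction n)
  case 0
  then show ?case by (simp add: mart_short)
next
  case (Suc n)
  show ?case
  proof (cases "N \<le> n")
    case False
    then show ?thesis by (simp add: mart_short)
  next
    case True
    have int: "integrable P (\<lambda>\<omega>. mart h (H n \<omega>) ^ k)" for k
      by (rule integrable_history_function)
    have "expectation (\<lambda>\<omega>. (mart h (H (Suc n) \<omega>))\<^sup>2) = expectation (\<lambda>\<omega>. step (\<lambda>w. (mart h w)\<^sup>2) (H n \<omega>))"
      by (rule expectation_Suc[OF True])
    also have "\<dots> \<le> expectation (\<lambda>\<omega>. (mart h (H n \<omega>))\<^sup>2 + 4)"
      using True by (intro integral_mono integrable_history_function step_mart_moments h) auto
    finally have two: "expectation (\<lambda>\<omega>. (mart h (H (Suc n) \<omega>))\<^sup>2) \<le> expectation (\<lambda>\<omega>. (mart h (H n \<omega>))\<^sup>2) + 4"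
      by (simp add: prob_space int)
    have "expectation (\<lambda>\<omega>. mart h (H (Suc n) \<omega>) ^ 4) = expectation (\<lambda>\<omega>. step (\<lambda>w. mart h w ^ 4) (H n \<omega>))"
      by (rule expectation_Suc[OF True])
    also have "\<dots> \<le> expectation (\<lambda>\<omega>. mart h (H n \<omega>) ^ 4 + 32 * (mart h (H n \<omega>))\<^sup>2 + 48)"
      using True by (intro integral_mono integrable_history_function step_mart_moments h) auto
    finally have "expectation (\<lambda>\<omega>. mart h (H (Suc n) \<omega>) ^ 4)
        \<le> expectation (\<lambda>\<omega>. mart h (H n \<omega>) ^ 4) + 32 * expectation (\<lambda>\<omega>. (mart h (H n \<omega>))\<^sup>2) + 48"
      by (simp add: prob_space int)
    with two Suc show ?thesis
      by (simp add: power2_eq_square algebra_simps)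
  qed
qed

lemma AE_mart_average_tendsto_0:
  assumes h: "\<And>w. \<bar>h w\<bar> \<le> 1"
  shows "AE \<omega> in P. (\<lambda>n. mart h (H n \<omega>) / real n) \<longlonglongrightarrow> 0"
proof (rule AE_tendsto_0_of_fourth_moment)
  show "expectation (\<lambda>\<omega>. mart h (H n \<omega>) ^ 4) \<le> 100 * (real n)\<^sup>2" for n
    using mart_moments[of h n] h by blast
qed auto

section \<open>The speed as a stationary mean\<close>

definition newest_jump :: "bool list \<Rightarrow> real"
  where "newest_jump w = (if w \<noteq> [] \<and> hd w then 1 else - 1)"

lemma windowed_newest_jump: "windowed newest_jump"
proof -
  have "newest_jump w = newest_jump (take N w)" for w
    using N_pos by (cases w; cases N) (auto simp: newest_jump_def)
  then show ?thesis unfolding windowed_def by metis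
qed

lemma path_eq_sum_jumps:
  assumes "\<And>k. jump x k \<in> {1, - 1}"
  shows "real_of_int (x n) = real_of_int (x 0)
    + (\<Sum>k<n. newest_jump (history (\<lambda>k. jump x k = 1) (Suc k)))"
proof (induction n)
  case (Suc n)
  then show ?case
    using assms[of n] by (auto simp: newest_jump_def jump_def)
qed simp

theorem AE_speed: "AE \<omega> in P. (\<lambda>n. real_of_int (X n \<omega>) / real n) \<longlonglongrightarrow> stat_mean newest_jump"
proof -
  have bd: "\<bar>newest_jump w\<bar> \<le> 1" for w
    by (simp add: newest_jump_def)
  \<comment> \<open>There are only countably many \<open>m\<close>, so a single null set serves for
    all of them.\<close>
  have "AE \<omega> in P. \<forall>m. (\<lambda>n. mart ((step ^^ m) newest_jump) (H n \<omega>) / real n) \<longlonglongrightarrow> 0"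
    by (intro AE_all_countable[THEN iffD2] allI AE_mart_average_tendsto_0 abs_funpow_step_le bd)
  with AE_admissible_path show ?thesis
  proof eventually_elim
    case (elim \<omega>)
    let ?J = "\<lambda>k. jump (\<lambda>j. X j \<omega>) k = 1"
    \<comment> \<open>The position sums the newest jumps of the histories at times \<open>1\<close>
      to \<open>n\<close>, the average those at times \<open>0\<close> to \<open>n - 1\<close>. The
      bounded term \<open>c n\<close> accounts for the shift and the start, and cancels the default
      value at the empty history.\<close>
    define c where "c n = real_of_int (X 0 \<omega>) + newest_jump (history ?J n) - newest_jump (history ?J 0)" for n
    have avg: "(\<lambda>n. (\<Sum>k<n. newest_jump (history ?J k)) / real n) \<longlonglongrightarrow> stat_mean newest_jump"
      using elim by (intro average_tendsto_stat_mean windowed_newest_jump bd) (simp add: H_def)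
    have "\<bar>c n\<bar> \<le> \<bar>real_of_int (X 0 \<omega>)\<bar> + 2" for n
      using bd[of "history ?J n"] bd[of "history ?J 0"] unfolding c_def by linarith
    then have "eventually (\<lambda>n. norm (c n / real n) \<le> (\<bar>real_of_int (X 0 \<omega>)\<bar> + 2) / real n) sequentially"
      by (intro always_eventually) (simp add: divide_right_mono)
    then have "(\<lambda>n. c n / real n) \<longlonglongrightarrow> 0"
      by (rule Lim_null_comparison) (rule lim_const_over_n)
    from tendsto_add[OF this avg]
    have "(\<lambda>n. c n / real n + (\<Sum>k<n. newest_jump (history ?J k)) / real n) \<longlonglongrightarrow> stat_mean newest_jump"
      by simp
    moreover have "real_of_int (X n \<omega>) = c n + (\<Sum>k<n. newest_jump (history ?J k))" for n
    proof -
      have "(\<Sum>k<n. newest_jump (history ?J (Suc k)) - newest_jump (history ?J k))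
          = newest_jump (history ?J n) - newest_jump (history ?J 0)"
        by (rule sum_lessThan_telescope)
      then show ?thesis
        using path_eq_sum_jumps[of "\<lambda>j. X j \<omega>" n] elim
        by (simp add: c_def sum_subtractf del: history.simps)
    qed
    ultimately show ?case by (simp add: add_divide_distrib)
  qed
qed

text \<open>The weight depends on the count alone, so the newest sign can be averaged over all
  orderings of the window.\<close>

lemma stat_mean_newest_jump:
  "stat_mean newest_jump = (\<Sum>j\<le>N. weight j * ((2 * real j / real N - 1) * real (N choose j)))
    / (\<Sum>j\<le>N. weight j * real (N choose j))"
proof -
  have "stat_sum newest_jump = (\<Sum>w | length w = N. (if hd w then 1 else - 1) * weight (count_list w True))"
    unfolding stat_sum_def using N_pos by (intro sum.cong) (auto simp: newest_jump_def)
  then show ?thesis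
    using sum_bool_lists_sign_hd_count[OF N_pos, of weight] sum_bool_lists_count[of weight N]
    by (simp add: stat_mean_def stat_sum_def mult_ac)
qed

end

section \<open>Regrouping by threshold blocks and the final formula\<close>

lemma sum_consecutive_blocks:
  fixes M :: "nat \<Rightarrow> nat" and g :: "nat \<Rightarrow> 'b::comm_monoid_add"
  assumes "M 0 = 0" "\<And>i. i \<le> l \<Longrightarrow> M i < M (Suc i)"
  shows "(\<Sum>i\<le>l. \<Sum>j = M i..M (Suc i) - 1. g j) = (\<Sum>j<M (Suc l). g j)"
proof -
  have "{M i..M (Suc i) - 1} = {M i..<M (Suc i)}" if "i \<le> l" for i
    using assms(2)[OF that] by auto
  then have "(\<Sum>i\<le>l. \<Sum>j = M i..M (Suc i) - 1. g j) = (\<Sum>i\<le>l. \<Sum>j\<in>{M i..<M (Suc i)}. g j)"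
    by (intro sum.cong) auto
  also have "\<dots> = (\<Sum>j<M (Suc l). g j)"
    using assms(2)
  proof (induction l)
    case 0
    then show ?case using assms(1) by (simp add: lessThan_atLeast0)
  next
    case (Suc l)
    have "M (Suc l) \<le> M (Suc (Suc l))"
      using Suc.prems[of "Suc l"] by simp
    then show ?case
      using Suc by (simp add: lessThan_atLeast0 sum.atLeastLessThan_concat)
  qed
  finally show ?thesis .
qed

lemma prod_consecutive_blocks:
  fixes M :: "nat \<Rightarrow> nat" and a b :: "nat \<Rightarrow> 'b::comm_monoid_mult"
  assumes "M 0 = 0" "\<And>i. i < l \<Longrightarrow> M i \<le> M (Suc i)"
    and block: "\<And>i m. i \<le> l \<Longrightarrow> M i \<le> m \<Longrightarrow> m < M (Suc i) \<Longrightarrow> b m = a i"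
    and i: "i \<le> l" "M i \<le> j" "j \<le> M (Suc i)"
  shows "(\<Prod>m<j. b m) = (\<Prod>k = 1..i. a (k - 1) ^ (M k - M (k - 1))) * a i ^ (j - M i)"
  using i
proof (induction i arbitrary: j)
  case 0
  have "(\<Prod>m<j. b m) = (\<Prod>m<j. a 0)"
    using 0 assms(1) block[of 0] by (intro prod.cong) auto
  then show ?case using assms(1) by simp
next
  case (Suc i)
  have "(\<Prod>m<j. b m) = (\<Prod>m<M (Suc i). b m) * (\<Prod>m\<in>{M (Suc i)..<j}. b m)"
    using Suc.prems by (simp add: lessThan_atLeast0 prod.atLeastLessThan_concat)
  moreover have "(\<Prod>m\<in>{M (Suc i)..<j}. b m) = (\<Prod>m\<in>{M (Suc i)..<j}. a (Suc i))"
    using Suc.prems block[of "Suc i"] by (intro prod.cong) auto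
  moreover have "(\<Prod>m<M (Suc i). b m) = (\<Prod>k = 1..i. a (k - 1) ^ (M k - M (k - 1))) * a i ^ (M (Suc i) - M i)"
    using Suc.prems assms(2)[of i] by (intro Suc.IH) auto
  ultimately show ?case by simp
qed

theorem theorem3:
  fixes P :: "'a measure" and X :: "nat \<Rightarrow> 'a \<Rightarrow> int" and x0 :: int
    and N l :: nat and M :: "nat \<Rightarrow> nat" and p :: "nat \<Rightarrow> real"
  assumes "l \<ge> 1" and "N \<ge> l"
    and "1 \<le> M 1" and "strict_mono_on {1..l} M" and "M l \<le> N"
    and "M 0 = 0" and "M (l + 1) = N + 1"
    and "0 < p 0" and "strict_mono_on {0..l} p" and "p l < 1"
    and "recent_history_walk P X x0 N l M p"
  shows "AE \<omega> in P. (\<lambda>n. real_of_int (X n \<omega>) / real n) \<longlonglongrightarrow>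
    (\<Sum>i = 0..l. 1 / (1 - p i)
        * (\<Prod>k = 1..i. (p (k - 1) / (1 - p (k - 1))) ^ (M k - M (k - 1)))
        * (\<Sum>j = M i..M (i + 1) - 1.
            (2 * real j / real N - 1) * real (N choose j) * (p i / (1 - p i)) ^ (j - M i)))
    / (\<Sum>i = 0..l. 1 / (1 - p i)
        * (\<Prod>k = 1..i. (p (k - 1) / (1 - p (k - 1))) ^ (M k - M (k - 1)))
        * (\<Sum>j = M i..M (i + 1) - 1.
            real (N choose j) * (p i / (1 - p i)) ^ (j - M i)))"
proof -
  \<comment> \<open>The conventions for \<open>M 0\<close> and \<open>M (l + 1)\<close> extend
    strict growth from the inner thresholds to all blocks.\<close>
  have M_less: "M i < M (Suc i)" if "i \<le> l" for i
  proof -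
    consider "i = 0" | "i = l" | "1 \<le> i" "i < l" using \<open>i \<le> l\<close> by linarith
    then show ?thesis
      using assms(3,5,6,7) strict_mono_onD[OF assms(4), of i "Suc i"] by cases auto
  qed
  define block where "block j = (LEAST i. j < M (Suc i))" for j
  \<comment> \<open>The chain needs bounds on \<open>r j\<close> for every \<open>j\<close>, also
    beyond \<open>N\<close>, where \<open>block j\<close> may exceed \<open>l\<close> or be
    meaningless; hence the cap at \<open>l\<close>.\<close>
  define r where "r j = p (min l (block j))" for j
  have block: "block j = i" if "i \<le> l" "M i \<le> j" "j < M (Suc i)" for i j
    unfolding block_def
  proof (rule Least_equality)
    fix k assume "j < M (Suc k)"
    show "i \<le> k"
    proof (rule ccontr)
      assume "\<not> i \<le> k"
      then have "Suc k \<le> i" by simp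
      then have "M (Suc k) \<le> M i"
        using \<open>i \<le> l\<close>
      proof (induction i rule: dec_induct)
        case (step m)
        then show ?case using M_less[of m] by simp
      qed simp
      then show False using \<open>j < M (Suc k)\<close> that by simp
    qed
  qed (rule that)
  have r: "r j = p i" if "i \<le> l" "M i \<le> j" "j < M (Suc i)" for i j
    using block[OF that] that by (simp add: r_def)
  have cover: "\<exists>i\<le>l. j \<in> {M i..M (i + 1) - 1} \<and> r j = p i" if "j \<le> N" for j
  proof -
    have ex: "j < M (Suc l)" using that assms(7) by simp
    have up: "j < M (Suc (block j))" unfolding block_def using ex by (rule LeastI)
    have le: "block j \<le> l" unfolding block_def using ex by (rule Least_le)
    have "M (block j) \<le> j"
    proof (cases "block j")
      case (Suc k)
      then show ?thesis using not_less_Least[of k "\<lambda>i. j < M (Suc i)"] by (simp add: block_def)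
    qed (simp add: assms(6))
    then show ?thesis using up le by (intro exI[of _ "block j"]) (auto simp: r_def)
  qed
  \<comment> \<open>Since \<open>p\<close> increases, all jump probabilities lie between
    \<open>p 0\<close> and \<open>p l\<close>.\<close>
  define \<epsilon> where "\<epsilon> = min (p 0) (1 - p l)"
  have p_bounds: "p 0 \<le> p i" "p i \<le> p l" if "i \<le> l" for i
    using that strict_mono_on_leD[OF assms(9)] by auto
  have chain: "window_chain N r \<epsilon>"
  proof
    show "N > 0" "\<epsilon> > 0" using assms(1,2,8,10) by (auto simp: \<epsilon>_def)
    show "\<epsilon> \<le> r j" "r j \<le> 1 - \<epsilon>" for j
      using p_bounds[of "min l (block j)"] by (auto simp: \<epsilon>_def r_def)
  qed
  interpret excited_walk P X x0 N l M p r \<epsilon>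
    using assms(11) chain cover by (simp add: excited_walk_def excited_walk_axioms_def)
  let ?Q = "\<lambda>i. \<Prod>k = 1..i. (p (k - 1) / (1 - p (k - 1))) ^ (M k - M (k - 1))"
  have weight: "weight j = 1 / (1 - p i) * ?Q i * (p i / (1 - p i)) ^ (j - M i)"
    if i: "i \<le> l" "M i \<le> j" "j < M (Suc i)" for i j
    unfolding weight_def r[OF i]
    using i M_less r assms(6)
    by (subst prod_consecutive_blocks[of M l _ "\<lambda>i. p i / (1 - p i)" i]) (auto intro: less_imp_le)
  \<comment> \<open>Keeping \<open>g\<close> general serves both sums: the binomial coefficient for
    the denominator, the same times the mean sign for the numerator.\<close>
  have formula: "(\<Sum>i = 0..l. 1 / (1 - p i) * ?Q i * (\<Sum>j = M i..M (i + 1) - 1. g j * (p i / (1 - p i)) ^ (j - M i)))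
      = (\<Sum>j\<le>N. weight j * g j)" for g
  proof -
    have "(\<Sum>j\<le>N. weight j * g j) = (\<Sum>i\<le>l. \<Sum>j = M i..M (Suc i) - 1. weight j * g j)"
      using sum_consecutive_blocks[of M l "\<lambda>j. weight j * g j"] M_less assms(6,7)
      by (simp add: lessThan_Suc_atMost)
    also have "\<dots> = (\<Sum>i = 0..l. 1 / (1 - p i) * ?Q i * (\<Sum>j = M i..M (i + 1) - 1. g j * (p i / (1 - p i)) ^ (j - M i)))"
      unfolding sum_distrib_left atMost_atLeast0
    proof (intro sum.cong)
      fix i j assume "i \<in> {0..l}" "j \<in> {M i..M (i + 1) - 1}"
      then have "weight j = 1 / (1 - p i) * ?Q i * (p i / (1 - p i)) ^ (j - M i)"
        using M_less[of i] by (intro weight) auto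
      then show "weight j * g j = 1 / (1 - p i) * ?Q i * (g j * (p i / (1 - p i)) ^ (j - M i))"
        by (simp only: mult_ac)
    qed auto
    finally show ?thesis by simp
  qed
  show ?thesis
    unfolding formula stat_mean_newest_jump[symmetric] by (rule AE_speed)
qed

end
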